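(* Let $$F_\varphi(X) = \langle X, t \;\|\; t^{-1} x t = \varphi(x),\ x \in X\rangle$$ be the extension of a free group $F(X)$ by a virtually inner automorphism $\varphi \in \mathrm{Aut}(F(X))$. Then the center $Z(F_\varphi(X))$ of $F_\varphi(X)$ is the infinite cyclic group generated by $t^n w_0$, where $n$ is the minimal natural number (positive integer) for which $\varphi^n \in \mathrm{Int}(F(X))$, and $w_0 \in F(X)$ is defined by the equality $\varphi^n(x) = w_0 x w_0^{-1}$, $x \in X$.
   Context: $F(X)$ is the free group with set of free generators $X$. $\mathrm{Int}(F(X))$ is the group of inner automorphisms of $F(X)$. An automorphism $\varphi$ of $F(X)$ is called virtually inner if $\varphi^k$ is an inner automorphism of $F(X)$ for some positive integer $k$.
   Formalization: The set X is assumed not to have exactly one element: for |X| = 1 and the identity automorphism the group is Z^2, whose center is not cyclic, and for |X| = 1 the defining equality does not determine w_0. *)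

theory Defs
  imports "HOL-Algebra.Bij" "HOL-Algebra.Generated_Groups"
begin

section \<open>Free groups\<close>

text \<open>
  The free group on a set \<open>S\<close> is realised by reduced words. The letter \<open>(x, True)\<close> stands for
  the generator \<open>x\<close>, and \<open>(x, False)\<close> for its formal inverse.
\<close>

type_synonym 'a word = "('a \<times> bool) list"

definition inv_letter :: "'a \<times> bool \<Rightarrow> 'a \<times> bool" where
  "inv_letter l = (fst l, \<not> snd l)"

definition reduced :: "'a word \<Rightarrow> bool" where
  "reduced = successively (\<lambda>l m. m \<noteq> inv_letter l)"

fun cons_reduce :: "'a \<times> bool \<Rightarrow> 'a word \<Rightarrow> 'a word" where
  "cons_reduce l [] = [l]"
| "cons_reduce l (m # w) = (if m = inv_letter l then w else l # m # w)"

text \<open>For reduced \<open>v\<close> and \<open>w\<close>, \<open>word_mult v w\<close> is the reduced form of the concatenation \<open>v @ w\<close>.\<close>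

definition word_mult :: "'a word \<Rightarrow> 'a word \<Rightarrow> 'a word" where
  "word_mult v w = foldr cons_reduce v w"

definition free_group :: "'a set \<Rightarrow> 'a word monoid" where
  "free_group S =
     \<lparr>carrier = {w. reduced w \<and> fst ` set w \<subseteq> S}, mult = word_mult, one = []\<rparr>"

definition free_gen :: "'a \<Rightarrow> 'a word" where
  "free_gen x = [(x, True)]"

lemma inv_letter_inv_letter [simp]: "inv_letter (inv_letter l) = l"
  by (simp add: inv_letter_def)

lemma fst_inv_letter [simp]: "fst (inv_letter l) = fst l"
  by (simp add: inv_letter_def)

lemma inv_letter_neq [simp]: "inv_letter l \<noteq> l" "l \<noteq> inv_letter l"
  by (auto simp: inv_letter_def prod_eq_iff)

lemma reduced_Nil [simp]: "reduced []"
  by (simp add: reduced_def)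

lemma reduced_Cons:
  "reduced (l # w) \<longleftrightarrow> (w = [] \<or> hd w \<noteq> inv_letter l) \<and> reduced w"
  by (auto simp: reduced_def successively_Cons)

lemma reduced_cons_reduce: "reduced w \<Longrightarrow> reduced (cons_reduce l w)"
  by (cases w) (auto simp: reduced_Cons)

lemma reduced_word_mult: "reduced w \<Longrightarrow> reduced (word_mult v w)"
  by (induction v) (auto simp: word_mult_def reduced_cons_reduce)

lemma letters_cons_reduce: "fst ` set (cons_reduce l w) \<subseteq> insert (fst l) (fst ` set w)"
  by (cases w) auto

lemma letters_word_mult: "fst ` set (word_mult v w) \<subseteq> fst ` set v \<union> fst ` set w"
proof (induction v)
  case (Cons l v)
  then show ?case
    using letters_cons_reduce[of l "word_mult v w"] unfolding word_mult_def
    by (simp only: foldr.simps comp_apply list.set image_insert) blast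
qed (simp add: word_mult_def)

lemma cons_reduce_cancel:
  assumes "reduced w"
  shows "cons_reduce l (cons_reduce (inv_letter l) w) = w"
proof (cases w)
  case (Cons m u)
  with assms show ?thesis
    by (cases u) (auto simp: reduced_Cons)
qed simp

lemma word_mult_Nil [simp]: "word_mult [] w = w"
  by (simp add: word_mult_def)

lemma word_mult_Cons [simp]: "word_mult (l # v) w = cons_reduce l (word_mult v w)"
  by (simp add: word_mult_def)

lemma word_mult_cons_reduce:
  assumes "reduced w"
  shows "word_mult (cons_reduce l v) w = cons_reduce l (word_mult v w)"
proof (cases v)
  case (Cons m u)
  then show ?thesis
    using cons_reduce_cancel[OF reduced_word_mult[OF assms], of l u] by auto
qed simp

lemma word_mult_assoc:
  assumes "reduced w"
  shows "word_mult (word_mult u v) w = word_mult u (word_mult v w)"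
  by (induction u) (simp_all add: word_mult_cons_reduce assms)

lemma word_mult_Nil_right: "reduced v \<Longrightarrow> word_mult v [] = v"
proof (induction v)
  case (Cons l v)
  then show ?case
    by (cases v) (auto simp: reduced_Cons)
qed simp

lemma word_mult_append: "word_mult (u @ v) w = word_mult u (word_mult v w)"
  by (induction u) auto

lemma word_mult_inverse:
  assumes "reduced w"
  shows "word_mult (rev (map inv_letter v)) (word_mult v w) = w"
  using assms
proof (induction v)
  case (Cons l v)
  have "cons_reduce (inv_letter l) (cons_reduce l (word_mult v w)) = word_mult v w"
    using cons_reduce_cancel[OF reduced_word_mult[OF Cons.prems], of "inv_letter l" v] by simp
  then show ?case
    using Cons by (simp add: word_mult_append)
qed simp

lemma reduced_inverse:
  assumes "reduced v"
  shows "reduced (rev (map inv_letter v))"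
  using assms unfolding reduced_def successively_rev successively_map
  by (rule successively_mono) auto

theorem group_free_group: "group (free_group S)"
proof (rule groupI)
  fix v w assume "v \<in> carrier (free_group S)" "w \<in> carrier (free_group S)"
  then show "v \<otimes>\<^bsub>free_group S\<^esub> w \<in> carrier (free_group S)"
    using order_trans[OF letters_word_mult[of v w], of S] by (simp add: free_group_def reduced_word_mult)
next
  fix v assume v: "v \<in> carrier (free_group S)"
  let ?v = "rev (map inv_letter v)"
  have "?v \<in> carrier (free_group S)"
    using v by (auto simp: free_group_def reduced_inverse image_subset_iff)
  moreover have "word_mult ?v v = []"
    using word_mult_inverse[of "[]" v] v by (simp add: free_group_def word_mult_Nil_right)
  ultimately show "\<exists>u\<in>carrier (free_group S). u \<otimes>\<^bsub>free_group S\<^esub> v = \<one>\<^bsub>free_group S\<^esub>"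
    by (intro bexI[of _ ?v]) (simp_all add: free_group_def)
qed (simp_all add: free_group_def word_mult_assoc)

lemma free_gen_closed [simp]: "free_gen x \<in> carrier (free_group S) \<longleftrightarrow> x \<in> S"
  by (simp add: free_gen_def free_group_def reduced_Cons)

lemma inj_free_gen: "inj free_gen"
  by (simp add: inj_def free_gen_def)

lemma inv_free_gen: "x \<in> S \<Longrightarrow> inv\<^bsub>free_group S\<^esub> (free_gen x) = [(x, False)]"
  by (rule group.inv_equality[OF group_free_group])
     (auto simp: free_group_def free_gen_def inv_letter_def reduced_Cons)


subsection \<open>The universal property\<close>

definition eval_letter :: "('b, 'c) monoid_scheme \<Rightarrow> ('a \<Rightarrow> 'b) \<Rightarrow> 'a \<times> bool \<Rightarrow> 'b" where
  "eval_letter H f l = (if snd l then f (fst l) else inv\<^bsub>H\<^esub> f (fst l))"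

definition eval_word :: "('b, 'c) monoid_scheme \<Rightarrow> ('a \<Rightarrow> 'b) \<Rightarrow> 'a word \<Rightarrow> 'b" where
  "eval_word H f w = foldr (\<lambda>l a. eval_letter H f l \<otimes>\<^bsub>H\<^esub> a) w \<one>\<^bsub>H\<^esub>"

theorem free_group_universal:
  assumes H: "group H" and f: "f \<in> S \<rightarrow> carrier H"
  shows "\<exists>h \<in> hom (free_group S) H. \<forall>x\<in>S. h (free_gen x) = f x"
    and "\<lbrakk>h \<in> hom (free_group S) H; h' \<in> hom (free_group S) H;
          \<And>x. x \<in> S \<Longrightarrow> h (free_gen x) = h' (free_gen x); w \<in> carrier (free_group S)\<rbrakk>
         \<Longrightarrow> h w = h' w"
proof -
  interpret H: group H by (rule H)
  interpret F: group "free_group S" by (rule group_free_group)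
  have lc: "eval_letter H f l \<in> carrier H" if "fst l \<in> S" for l
    using f that by (auto simp: eval_letter_def)
  have ec: "eval_word H f w \<in> carrier H" if "fst ` set w \<subseteq> S" for w
    using that by (induction w) (auto simp: eval_word_def lc)
  have ecr: "eval_word H f (cons_reduce l w) = eval_letter H f l \<otimes>\<^bsub>H\<^esub> eval_word H f w"
    if "fst l \<in> S" "fst ` set w \<subseteq> S" for l w
  proof (cases w)
    case (Cons m u)
    have "eval_letter H f l \<otimes>\<^bsub>H\<^esub> (eval_letter H f (inv_letter l) \<otimes>\<^bsub>H\<^esub> eval_word H f u)
            = eval_word H f u"
    proof -
      have "eval_letter H f l \<otimes>\<^bsub>H\<^esub> eval_letter H f (inv_letter l) = \<one>\<^bsub>H\<^esub>"
        using f that(1) by (auto simp: eval_letter_def inv_letter_def Pi_iff)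
      moreover have "eval_letter H f l \<in> carrier H" "eval_letter H f (inv_letter l) \<in> carrier H"
        "eval_word H f u \<in> carrier H"
        using that Cons by (auto intro!: lc ec)
      ultimately show ?thesis
        using H.m_assoc[of "eval_letter H f l" "eval_letter H f (inv_letter l)" "eval_word H f u"]
        by simp
    qed
    then show ?thesis
      using Cons by (auto simp: eval_word_def)
  qed (simp add: eval_word_def)
  have em: "eval_word H f (word_mult v w) = eval_word H f v \<otimes>\<^bsub>H\<^esub> eval_word H f w"
    if "fst ` set v \<subseteq> S" "fst ` set w \<subseteq> S" for v w
    using that
  proof (induction v)
    case Nil
    then show ?case using ec[of w] by (simp add: eval_word_def)
  next
    case (Cons l v)
    have "fst ` set (word_mult v w) \<subseteq> S"
      using order_trans[OF letters_word_mult[of v w], of S] Cons.prems by simp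
    moreover have "eval_word H f (l # v) = eval_letter H f l \<otimes>\<^bsub>H\<^esub> eval_word H f v"
      by (simp add: eval_word_def)
    ultimately show ?case
      using Cons lc[of l] ec[of v] ec[of w] by (simp add: ecr H.m_assoc)
  qed
  have "eval_word H f \<in> hom (free_group S) H"
    by (rule homI) (auto simp: free_group_def intro!: ec em)
  moreover have "\<forall>x\<in>S. eval_word H f (free_gen x) = f x"
    using f by (auto simp: eval_word_def eval_letter_def free_gen_def Pi_iff)
  ultimately show "\<exists>h \<in> hom (free_group S) H. \<forall>x\<in>S. h (free_gen x) = f x"
    by blast
next
  assume h: "h \<in> hom (free_group S) H" and h': "h' \<in> hom (free_group S) H"
    and eq: "\<And>x. x \<in> S \<Longrightarrow> h (free_gen x) = h' (free_gen x)"
  interpret h: group_hom "free_group S" H h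
    using H h by (simp add: group_hom_def group_hom_axioms_def group_free_group)
  interpret h': group_hom "free_group S" H h'
    using H h' by (simp add: group_hom_def group_hom_axioms_def group_free_group)
  have leq: "h [l] = h' [l]" if "fst l \<in> S" for l
  proof (cases "snd l")
    case True
    then have "[l] = free_gen (fst l)" by (simp add: free_gen_def prod_eq_iff)
    then show ?thesis using eq that by simp
  next
    case False
    then have "[l] = inv\<^bsub>free_group S\<^esub> free_gen (fst l)"
      using that by (simp add: inv_free_gen prod_eq_iff)
    then show ?thesis using eq that by simp
  qed
  show "w \<in> carrier (free_group S) \<Longrightarrow> h w = h' w"
  proof (induction w)
    case Nil
    then show ?case
      using h.hom_one h'.hom_one by (simp add: free_group_def)
  next
    case (Cons l w)
    have w: "w \<in> carrier (free_group S)" and l: "[l] \<in> carrier (free_group S)" "fst l \<in> S"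
      using Cons.prems by (auto simp: free_group_def reduced_Cons)
    have "l # w = [l] \<otimes>\<^bsub>free_group S\<^esub> w"
      using Cons.prems by (cases w) (auto simp: free_group_def reduced_Cons)
    then show ?case
      using Cons.IH[OF w] leq[OF l(2)] w l by simp
  qed
qed


section \<open>Groups given by generators and relators\<close>

definition normal_closure :: "('a, 'b) monoid_scheme \<Rightarrow> 'a set \<Rightarrow> 'a set" where
  "normal_closure G R = \<Inter> {N. N \<lhd> G \<and> R \<subseteq> N}"

definition presented_group :: "'a set \<Rightarrow> 'a word set \<Rightarrow> 'a word set monoid" where
  "presented_group S R = free_group S Mod normal_closure (free_group S) R"

text \<open>The element of \<open>presented_group S R\<close> represented by an element of \<open>free_group S\<close>.\<close>

definition pres_class :: "'a set \<Rightarrow> 'a word set \<Rightarrow> 'a word \<Rightarrow> 'a word set" where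
  "pres_class S R w = normal_closure (free_group S) R #>\<^bsub>free_group S\<^esub> w"

lemma (in group) normal_normal_closure:
  assumes "R \<subseteq> carrier G"
  shows "normal_closure G R \<lhd> G" "R \<subseteq> normal_closure G R"
proof -
  let ?A = "{N. N \<lhd> G \<and> R \<subseteq> N}"
  have G: "carrier G \<in> ?A"
    using assms by (auto simp: normal_inv_iff subgroup_self)
  have "subgroup (\<Inter>?A) G"
    using G by (intro subgroups_Inter) (auto simp: normal_inv_iff)
  then show "normal_closure G R \<lhd> G"
    by (auto simp: normal_inv_iff normal_closure_def)
  show "R \<subseteq> normal_closure G R"
    by (auto simp: normal_closure_def)
qed

theorem group_presented_group:
  assumes "R \<subseteq> carrier (free_group S)"
  shows "group (presented_group S R)"
  unfolding presented_group_def
  by (intro normal.factorgroup_is_group group.normal_normal_closure group_free_group assms)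


section \<open>Inner automorphisms, virtually inner automorphisms, and the center\<close>

definition inner_auts :: "('a, 'b) monoid_scheme \<Rightarrow> ('a \<Rightarrow> 'a) set" where
  "inner_auts G = (\<lambda>g. \<lambda>x\<in>carrier G. g \<otimes>\<^bsub>G\<^esub> x \<otimes>\<^bsub>G\<^esub> inv\<^bsub>G\<^esub> g) ` carrier G"

definition virtually_inner :: "('a, 'b) monoid_scheme \<Rightarrow> ('a \<Rightarrow> 'a) \<Rightarrow> bool" where
  "virtually_inner G \<phi> \<longleftrightarrow>
     \<phi> \<in> carrier (AutoGroup G) \<and> (\<exists>k::nat. k > 0 \<and> \<phi> [^]\<^bsub>AutoGroup G\<^esub> k \<in> inner_auts G)"

definition is_conjugator :: "'a set \<Rightarrow> ('a word \<Rightarrow> 'a word) \<Rightarrow> 'a word \<Rightarrow> bool" where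
  "is_conjugator X \<psi> w \<longleftrightarrow> w \<in> carrier (free_group X) \<and>
     (\<forall>x\<in>X. \<psi> (free_gen x) =
        w \<otimes>\<^bsub>free_group X\<^esub> free_gen x \<otimes>\<^bsub>free_group X\<^esub> inv\<^bsub>free_group X\<^esub> w)"

definition center :: "('a, 'b) monoid_scheme \<Rightarrow> 'a set" where
  "center G = {z \<in> carrier G. \<forall>g\<in>carrier G. z \<otimes>\<^bsub>G\<^esub> g = g \<otimes>\<^bsub>G\<^esub> z}"


section \<open>The extension of a free group by an automorphism\<close>

text \<open>
  The generating set is the disjoint union of \<open>X\<close> and \<open>{t}\<close>, with \<open>Some x\<close> for \<open>x \<in> X\<close> and
  \<open>None\<close> for the stable letter \<open>t\<close>. The relation \<open>t\<inverse> x t = \<phi>(x)\<close> is encoded by the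
  relator \<open>t\<inverse> x t \<phi>(x)\<inverse>\<close>, where \<open>lift_word\<close> is the inclusion of the free group on \<open>X\<close> into
  the free group on \<open>X \<union> {t}\<close>.
\<close>

definition ext_gens :: "'a set \<Rightarrow> 'a option set" where
  "ext_gens X = insert None (Some ` X)"

definition lift_word :: "'a word \<Rightarrow> 'a option word" where
  "lift_word w = map (map_prod Some id) w"

definition ext_rels :: "'a set \<Rightarrow> ('a word \<Rightarrow> 'a word) \<Rightarrow> 'a option word set" where
  "ext_rels X \<phi> =
     (let F = free_group (ext_gens X); t = free_gen None in
      (\<lambda>x. inv\<^bsub>F\<^esub> t \<otimes>\<^bsub>F\<^esub> free_gen (Some x) \<otimes>\<^bsub>F\<^esub> t \<otimes>\<^bsub>F\<^esub> inv\<^bsub>F\<^esub> lift_word (\<phi> (free_gen x))) ` X)"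

definition ext_group :: "'a set \<Rightarrow> ('a word \<Rightarrow> 'a word) \<Rightarrow> 'a option word set monoid" where
  "ext_group X \<phi> = presented_group (ext_gens X) (ext_rels X \<phi>)"

definition ext_t :: "'a set \<Rightarrow> ('a word \<Rightarrow> 'a word) \<Rightarrow> 'a option word set" where
  "ext_t X \<phi> = pres_class (ext_gens X) (ext_rels X \<phi>) (free_gen None)"

text \<open>The natural map from the free group on \<open>X\<close> to the extension.\<close>

definition ext_incl :: "'a set \<Rightarrow> ('a word \<Rightarrow> 'a word) \<Rightarrow> 'a word \<Rightarrow> 'a option word set" where
  "ext_incl X \<phi> w = pres_class (ext_gens X) (ext_rels X \<phi>) (lift_word w)"

lemma lift_word_closed:
  assumes "w \<in> carrier (free_group X)"
  shows "lift_word w \<in> carrier (free_group (ext_gens X))"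
proof -
  have "reduced (lift_word w)" if "reduced w" for w :: "'a word"
    using that
  proof (induction w)
    case (Cons l w)
    then show ?case
      by (cases w) (auto simp: lift_word_def reduced_Cons inv_letter_def prod_eq_iff)
  qed (simp add: lift_word_def)
  with assms show ?thesis
    by (auto simp: free_group_def lift_word_def ext_gens_def)
qed

lemma ext_rels_closed:
  assumes "\<phi> \<in> carrier (AutoGroup (free_group X))"
  shows "ext_rels X \<phi> \<subseteq> carrier (free_group (ext_gens X))"
proof -
  interpret F: group "free_group (ext_gens X)" by (rule group_free_group)
  have t: "free_gen None \<in> carrier (free_group (ext_gens X))"
    by (simp add: ext_gens_def)
  have x: "free_gen (Some x) \<in> carrier (free_group (ext_gens X))" if "x \<in> X" for x
    using that by (simp add: ext_gens_def)
  have hom: "\<phi> \<in> hom (free_group X) (free_group X)"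
    using assms by (simp add: AutoGroup_def auto_def)
  have "\<phi> (free_gen x) \<in> carrier (free_group X)" if "x \<in> X" for x
    by (rule hom_in_carrier[OF hom]) (simp add: that)
  then have "lift_word (\<phi> (free_gen x)) \<in> carrier (free_group (ext_gens X))" if "x \<in> X" for x
    using that lift_word_closed by blast
  then show ?thesis
    unfolding ext_rels_def Let_def
    by (intro image_subsetI F.m_closed F.inv_closed t x)
qed

theorem group_ext_group:
  "\<phi> \<in> carrier (AutoGroup (free_group X)) \<Longrightarrow> group (ext_group X \<phi>)"
  unfolding ext_group_def by (intro group_presented_group ext_rels_closed)

end

theory Submission
  imports Defs "HOL-Algebra.Elementary_Groups"
begin

text \<open>
  Let \<open>E\<close> be the extension and \<open>F = F(X)\<close>. Every element of \<open>E\<close> has the form \<open>t\<^sup>m u\<close> with \<open>u \<in> F\<close>, and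
  \<open>m\<close> is its image under the homomorphism to the integers killing \<open>X\<close>. The element \<open>t\<^sup>n w\<^sub>0\<close> commutes
  with \<open>F\<close> by the choice of \<open>w\<^sub>0\<close>, and with \<open>t\<close> because \<open>\<phi>\<close> commutes with \<open>\<phi>\<^sup>n\<close>, which forces
  \<open>\<phi>(w\<^sub>0) = w\<^sub>0\<close> as \<open>F\<close> is centreless. Multiplying a central element by a power of \<open>t\<^sup>n w\<^sub>0\<close> we may
  assume \<open>0 \<le> m < n\<close>; then \<open>\<phi>\<^sup>m\<close> is conjugation by \<open>u\<close>, so \<open>m = 0\<close> by minimality of \<open>n\<close>, and
  \<open>u = 1\<close> since it is central in \<open>F\<close>.
\<close>

section \<open>Automorphism groups\<close>

lemma AutoGroup_simps:
  "carrier (AutoGroup G) = auto G"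
  "\<one>\<^bsub>AutoGroup G\<^esub> = (\<lambda>x\<in>carrier G. x)"
  "\<lbrakk>f \<in> auto G; g \<in> auto G\<rbrakk> \<Longrightarrow> f \<otimes>\<^bsub>AutoGroup G\<^esub> g = compose (carrier G) f g"
  by (auto simp: AutoGroup_def BijGroup_def auto_def)

lemma auto_eqI:
  assumes "f \<in> auto G" "g \<in> auto G" "\<And>x. x \<in> carrier G \<Longrightarrow> f x = g x"
  shows "f = g"
  using assms by (auto simp: auto_def intro: extensionalityI dest!: Bij_imp_extensional)

text \<open>Named as a function of g so that it can serve as the homomorphism from G to Aut(G) with
  image \<open>inner_auts G\<close>.\<close>

definition conj_aut :: "('a, 'b) monoid_scheme \<Rightarrow> 'a \<Rightarrow> 'a \<Rightarrow> 'a" where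
  "conj_aut G g = (\<lambda>x\<in>carrier G. g \<otimes>\<^bsub>G\<^esub> x \<otimes>\<^bsub>G\<^esub> inv\<^bsub>G\<^esub> g)"

lemma inner_auts_conj_aut: "inner_auts G = conj_aut G ` carrier G"
  by (simp add: inner_auts_def conj_aut_def)

context group
begin

text \<open>Conjugation by \<open>x\<close> links \<open>a\<close> and \<open>b\<close>, so
  conjugation by its inverse links them the other way. This turns commutation rules for positive
  powers of t into rules for negative ones, and a rule for \<phi> into one for its inverse.\<close>

lemma intertwine_inv:
  assumes "a \<otimes> x = x \<otimes> b" "a \<in> carrier G" "b \<in> carrier G" "x \<in> carrier G"
  shows "b \<otimes> inv x = inv x \<otimes> a"
proof -
  have "b = inv x \<otimes> (a \<otimes> x)"
    using assms by (simp add: m_assoc[symmetric] assms(1))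
  then show ?thesis
    using assms(2-) by (simp add: m_assoc)
qed

lemma subgroup_center: "subgroup (center G) G"
proof (rule subgroupI)
  have "\<one> \<in> center G"
    by (simp add: center_def)
  then show "center G \<noteq> {}" by blast
next
  fix a assume "a \<in> center G"
  then have a: "a \<in> carrier G" "\<And>g. g \<in> carrier G \<Longrightarrow> a \<otimes> g = g \<otimes> a"
    by (auto simp: center_def)
  then show "inv a \<in> center G"
    by (auto simp: center_def intro!: intertwine_inv[symmetric] a(2)[symmetric])
next
  fix a b assume "a \<in> center G" "b \<in> center G"
  then have a: "a \<in> carrier G" "\<And>g. g \<in> carrier G \<Longrightarrow> a \<otimes> g = g \<otimes> a"
    and b: "b \<in> carrier G" "\<And>g. g \<in> carrier G \<Longrightarrow> b \<otimes> g = g \<otimes> b"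
    by (auto simp: center_def)
  have "a \<otimes> b \<otimes> g = g \<otimes> (a \<otimes> b)" if g: "g \<in> carrier G" for g
  proof -
    have "a \<otimes> b \<otimes> g = a \<otimes> (b \<otimes> g)"
      using a(1) b(1) g by (rule m_assoc)
    also have "\<dots> = a \<otimes> (g \<otimes> b)"
      using b(2)[OF g] by (rule arg_cong)
    also have "\<dots> = a \<otimes> g \<otimes> b"
      using a(1) b(1) g by (simp only: m_assoc)
    also have "\<dots> = g \<otimes> (a \<otimes> b)"
      unfolding a(2)[OF g] using a(1) b(1) g by (simp only: m_assoc)
    finally show ?thesis .
  qed
  then show "a \<otimes> b \<in> center G"
    using a(1) b(1) by (simp add: center_def)
qed (auto simp: center_def)

lemma conj_aut_auto:
  assumes g: "g \<in> carrier G"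
  shows "conj_aut G g \<in> auto G"
proof -
  have "conj_aut G g \<in> hom G G"
  proof (rule homI)
    fix x y assume "x \<in> carrier G" "y \<in> carrier G"
    with g show "conj_aut G g (x \<otimes> y) = conj_aut G g x \<otimes> conj_aut G g y"
      by (simp add: conj_aut_def m_assoc m_assoc[symmetric, of "inv g" g])
  qed (use g in \<open>simp add: conj_aut_def\<close>)
  moreover have "bij_betw (conj_aut G g) (carrier G) (carrier G)"
    by (rule bij_betw_byWitness[where f' = "\<lambda>x. inv g \<otimes> x \<otimes> g"])
       (use g in \<open>auto simp: conj_aut_def m_assoc m_assoc[symmetric, of g "inv g"]
          m_assoc[symmetric, of "inv g" g]\<close>)
  ultimately show ?thesis
    by (simp add: auto_def Bij_def conj_aut_def)
qed

lemma conj_aut_hom: "conj_aut G \<in> hom G (AutoGroup G)"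
proof (rule homI)
  fix g h assume gh: "g \<in> carrier G" "h \<in> carrier G"
  then show "conj_aut G (g \<otimes> h) = conj_aut G g \<otimes>\<^bsub>AutoGroup G\<^esub> conj_aut G h"
    by (simp add: AutoGroup_simps conj_aut_auto)
       (auto simp: compose_def conj_aut_def m_assoc inv_mult_group intro!: restrict_ext)
qed (simp add: AutoGroup_simps conj_aut_auto)

text \<open>An automorphism carries \<open>g x g^-1\<close> to \<open>a(g) a(x) a(g)^-1\<close>.
  This is the relation of the extension inside Aut(G), up to inverting \<open>a\<close>.\<close>

lemma auto_conj_aut:
  assumes a: "a \<in> auto G" and g: "g \<in> carrier G"
  shows "a \<otimes>\<^bsub>AutoGroup G\<^esub> conj_aut G g = conj_aut G (a g) \<otimes>\<^bsub>AutoGroup G\<^esub> a"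
proof -
  interpret a: group_hom G G a
    using a by unfold_locales (simp add: auto_def)
  show ?thesis
    using a g by (simp add: AutoGroup_simps conj_aut_auto)
       (auto simp: compose_def conj_aut_def intro!: restrict_ext)
qed

text \<open>The kernel of the map from g to conjugation by g is the center.\<close>

lemma inj_conj_aut:
  assumes "center G = {\<one>}"
  shows "inj_on (conj_aut G) (carrier G)"
proof -
  interpret A: group "AutoGroup G" by (rule AutoGroup)
  interpret c: group_hom G "AutoGroup G" "conj_aut G"
    by unfold_locales (rule conj_aut_hom)
  have "g = \<one>" if g: "g \<in> carrier G" and "conj_aut G g = \<one>\<^bsub>AutoGroup G\<^esub>" for g
  proof -
    have "g \<otimes> x \<otimes> inv g = x" if "x \<in> carrier G" for x
      using that fun_cong[OF \<open>conj_aut G g = _\<close>, of x] by (simp add: conj_aut_def AutoGroup_simps)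
    then have "g \<otimes> x = x \<otimes> g" if "x \<in> carrier G" for x
      using that g inv_solve_right'[of x "g \<otimes> x" g] by fastforce
    then have "g \<in> center G"
      using g by (simp add: center_def)
    then show ?thesis using assms by simp
  qed
  then show ?thesis
    unfolding c.inj_iff_trivial_ker by (auto simp: kernel_def)
qed

text \<open>One factor can be peeled off at either end; comparing the two recursions shows that
  \<phi> commutes with its powers, as \<open>\<phi>_w\<close> needs.\<close>

lemma auto_pow_apply:
  assumes "\<phi> \<in> auto G"
  shows "\<phi> [^]\<^bsub>AutoGroup G\<^esub> (k::nat) \<in> auto G"
    and "u \<in> carrier G \<Longrightarrow> (\<phi> [^]\<^bsub>AutoGroup G\<^esub> Suc k) u = (\<phi> [^]\<^bsub>AutoGroup G\<^esub> k) (\<phi> u)"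
    and "u \<in> carrier G \<Longrightarrow> (\<phi> [^]\<^bsub>AutoGroup G\<^esub> Suc k) u = \<phi> ((\<phi> [^]\<^bsub>AutoGroup G\<^esub> k) u)"
proof -
  interpret A: group "AutoGroup G" by (rule AutoGroup)
  show *: "\<phi> [^]\<^bsub>AutoGroup G\<^esub> k \<in> auto G" for k :: nat
    using A.nat_pow_closed[of \<phi> k] assms by (simp add: AutoGroup_simps)
  show "u \<in> carrier G \<Longrightarrow> (\<phi> [^]\<^bsub>AutoGroup G\<^esub> Suc k) u = (\<phi> [^]\<^bsub>AutoGroup G\<^esub> k) (\<phi> u)"
    using assms * by (simp add: AutoGroup_simps compose_def)
  show "u \<in> carrier G \<Longrightarrow> (\<phi> [^]\<^bsub>AutoGroup G\<^esub> Suc k) u = \<phi> ((\<phi> [^]\<^bsub>AutoGroup G\<^esub> k) u)"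
    using assms * A.nat_pow_Suc2[of \<phi> k] by (simp add: AutoGroup_simps compose_def del: nat_pow_Suc)
qed

end


section \<open>Extensions by a single automorphism\<close>

text \<open>Abstracts what the computation of the center uses, so that it runs on normal forms
  instead of cosets of words. The map \<epsilon> is the exponent sum of t; it shows that t has
  infinite order and that the exponent in a normal form is unique.\<close>

locale cyclic_extension = G: group G + F: group F + i: group_hom F G i
  for G (structure) and F and i +
  fixes \<phi> and t and \<epsilon>
  assumes inj_i: "inj_on i (carrier F)"
    and \<phi>: "\<phi> \<in> auto F"
    and t: "t \<in> carrier G"
    and conj_t: "\<And>u. u \<in> carrier F \<Longrightarrow> i u \<otimes> t = t \<otimes> i (\<phi> u)"
    and generated: "carrier G = generate G (insert t (i ` carrier F))"
    and \<epsilon>: "\<epsilon> \<in> hom G integer_group"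
    and \<epsilon>_t: "\<epsilon> t = 1"
    and \<epsilon>_i: "\<And>u. u \<in> carrier F \<Longrightarrow> \<epsilon> (i u) = 0"
begin

sublocale \<epsilon>: group_hom G integer_group \<epsilon>
  using \<epsilon> by (simp add: group_hom_def group_hom_axioms_def)

sublocale \<phi>: group_hom F F \<phi>
  using \<phi> by unfold_locales (simp add: auto_def)

lemma \<phi>_image: "\<phi> ` carrier F = carrier F"
  using \<phi> by (simp add: auto_def Bij_def bij_betw_def)

abbreviation \<phi>_pow :: "nat \<Rightarrow> 'c \<Rightarrow> 'c" where
  "\<phi>_pow k \<equiv> \<phi> [^]\<^bsub>AutoGroup F\<^esub> k"

section \<open>Normal forms t^m u in the extension\<close>

lemma \<phi>_pow_image: "\<phi>_pow k ` carrier F = carrier F"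
  using F.auto_pow_apply(1)[OF \<phi>, of k] by (simp add: auto_def Bij_def bij_betw_def)

lemma \<phi>_pow_closed: "u \<in> carrier F \<Longrightarrow> \<phi>_pow k u \<in> carrier F"
  using \<phi>_pow_image[of k] by blast

text \<open>Induction on k moves one t at a time; u must vary because the step replaces u by
  \<phi>(u).\<close>

lemma conj_t_pow: "u \<in> carrier F \<Longrightarrow> i u \<otimes> t [^] k = t [^] k \<otimes> i (\<phi>_pow k u)"
proof (induction k arbitrary: u)
  case 0
  then show ?case by (simp add: AutoGroup_simps)
next
  case (Suc k)
  have "\<phi>_pow (Suc k) u = \<phi>_pow k (\<phi> u)"
    using Suc.prems by (rule F.auto_pow_apply(2)[OF \<phi>])
  moreover have "\<phi>_pow k (\<phi> u) \<in> carrier F"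
    using Suc.prems by (simp add: \<phi>_pow_closed)
  moreover have "i u \<otimes> t [^] Suc k = (i u \<otimes> t) \<otimes> t [^] k"
    using Suc.prems t by (simp only: G.nat_pow_Suc2) (simp add: G.m_assoc)
  moreover have "t \<otimes> (i (\<phi> u) \<otimes> t [^] k) = t \<otimes> (t [^] k \<otimes> i (\<phi>_pow k (\<phi> u)))"
    using Suc by simp
  ultimately show ?case
    using Suc.prems t by (simp only: G.nat_pow_Suc2 conj_t) (simp add: G.m_assoc)
qed

text \<open>For negative exponents, surjectivity of the power of \<phi> supplies a preimage. Hence
  the existential: inverse powers of \<phi> never have to be named.\<close>

lemma conj_t_int_pow:
  assumes u: "u \<in> carrier F"
  shows "\<exists>v\<in>carrier F. i u \<otimes> t [^] (m::int) = t [^] m \<otimes> i v"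
proof (cases m rule: int_cases2)
  case (nonneg k)
  then show ?thesis
    using conj_t_pow[OF u, of k] \<phi>_pow_closed[OF u]
    by (intro bexI[of _ "\<phi>_pow k u"]) (auto simp: int_pow_int)
next
  case (nonpos k)
  obtain v where v: "v \<in> carrier F" "u = \<phi>_pow k v"
    using \<phi>_pow_image[of k] u by blast
  have "i v \<otimes> t [^] k = t [^] k \<otimes> i u"
    using conj_t_pow v by simp
  then have "i u \<otimes> inv (t [^] k) = inv (t [^] k) \<otimes> i v"
    using t u v by (intro G.intertwine_inv) auto
  then show ?thesis
    using nonpos v t by (auto simp: G.int_pow_neg_int)
qed

lemma normal_form:
  assumes "z \<in> carrier G"
  shows "\<exists>m::int. \<exists>u\<in>carrier F. z = t [^] m \<otimes> i u"
proof -
  have "z \<in> generate G (insert t (i ` carrier F))"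
    using assms generated by simp
  then show ?thesis
  proof induction
    case one
    then show ?case
      by (intro exI[of _ 0] bexI[of _ "\<one>\<^bsub>F\<^esub>"]) auto
  next
    case (incl h)
    then consider "h = t" | u where "u \<in> carrier F" "h = i u" by blast
    then show ?case
    proof cases
      case 1
      then show ?thesis using t by (intro exI[of _ 1] bexI[of _ "\<one>\<^bsub>F\<^esub>"]) auto
    next
      case 2
      then show ?thesis by (intro exI[of _ 0] bexI[of _ u]) auto
    qed
  next
    case (inv h)
    then consider "h = t" | u where "u \<in> carrier F" "h = i u" by blast
    then show ?case
    proof cases
      case 1
      then show ?thesis
        using t by (intro exI[of _ "-1"] bexI[of _ "\<one>\<^bsub>F\<^esub>"]) (auto simp: G.int_pow_neg)
    next
      case 2
      then show ?thesis by (intro exI[of _ 0] bexI[of _ "inv\<^bsub>F\<^esub> u"]) auto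
    qed
  next
    case (eng g h)
    then obtain m k u v where u: "u \<in> carrier F" "g = t [^] (m::int) \<otimes> i u"
      and v: "v \<in> carrier F" "h = t [^] (k::int) \<otimes> i v" by blast
    \<comment> \<open>Moving t^k to the left past u only replaces u by another element of F, so
      products return to normal form.\<close>
    obtain u' where u': "u' \<in> carrier F" "i u \<otimes> t [^] k = t [^] k \<otimes> i u'"
      using conj_t_int_pow[OF u(1)] by blast
    have "g \<otimes> h = t [^] m \<otimes> (i u \<otimes> t [^] k) \<otimes> i v"
      using u v t by (simp add: G.m_assoc)
    also have "\<dots> = t [^] (m + k) \<otimes> i (u' \<otimes>\<^bsub>F\<^esub> v)"
      unfolding u'(2) using u' v t by (simp add: G.m_assoc G.int_pow_mult)
    finally show ?case
      using u' v by blast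
  qed
qed

lemma \<epsilon>_normal_form: "u \<in> carrier F \<Longrightarrow> \<epsilon> (t [^] (m::int) \<otimes> i u) = m"
  using t by (simp add: \<epsilon>.hom_int_pow \<epsilon>_t \<epsilon>_i)

section \<open>The center, given the least inner power of \<phi>\<close>

context
  fixes n :: nat and w
  assumes center_F: "center F = {\<one>\<^bsub>F\<^esub>}"
    and n_pos: "n > 0"
    and minimal: "\<And>k. 0 < k \<Longrightarrow> k < n \<Longrightarrow> \<phi>_pow k \<notin> inner_auts F"
    and w: "w \<in> carrier F"
    and \<phi>_pow_n: "\<And>u. u \<in> carrier F \<Longrightarrow> \<phi>_pow n u = w \<otimes>\<^bsub>F\<^esub> u \<otimes>\<^bsub>F\<^esub> inv\<^bsub>F\<^esub> w"
begin

text \<open>With v = \<phi>(u), applying \<phi> to \<open>\<phi>^n(u) = w u w^-1\<close> gives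
  \<open>\<phi>(w) v \<phi>(w)^-1 = \<phi>^n(v) = w v w^-1\<close>. So \<phi>(w) and w induce the
  same conjugation, which determines the element when the center is trivial.\<close>

lemma \<phi>_w: "\<phi> w = w"
proof -
  have "conj_aut F (\<phi> w) v = conj_aut F w v" if "v \<in> carrier F" for v
  proof -
    obtain u where u: "u \<in> carrier F" "v = \<phi> u"
      using \<phi>_image \<open>v \<in> carrier F\<close> by blast
    have "\<phi>_pow n (\<phi> u) = \<phi> (\<phi>_pow n u)"
      using F.auto_pow_apply[OF \<phi>] u by metis
    then show ?thesis
      using u w \<phi>_pow_n by (simp add: conj_aut_def)
  qed
  then have "conj_aut F (\<phi> w) = conj_aut F w"
    using w by (intro auto_eqI[of _ F]) (auto intro: F.conj_aut_auto)
  then show ?thesis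
    using F.inj_conj_aut[OF center_F] w by (auto dest: inj_onD)
qed

lemma central_generator: "t [^] n \<otimes> i w \<in> center G"
proof -
  let ?z = "t [^] n \<otimes> i w"
  have z: "?z \<in> carrier G" using t w by simp
  have z_t: "?z \<otimes> t = t \<otimes> ?z"
  proof -
    \<comment> \<open>Here \<phi>(w) = w lets t pass \<open>i w\<close> without changing it.\<close>
    have "?z \<otimes> t = (t [^] n \<otimes> t) \<otimes> i w"
      using t w conj_t[OF w] by (simp add: G.m_assoc \<phi>_w)
    also have "\<dots> = (t \<otimes> t [^] n) \<otimes> i w"
      using G.nat_pow_Suc2[OF t, of n] by simp
    finally show ?thesis
      using t w by (simp add: G.m_assoc)
  qed
  have z_i: "?z \<otimes> i u = i u \<otimes> ?z" if u: "u \<in> carrier F" for u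
  proof -
    have "i u \<otimes> ?z = (i u \<otimes> t [^] n) \<otimes> i w"
      using t w u by (simp add: G.m_assoc)
    \<comment> \<open>Moving t^n to the left of u conjugates u by w; the next step cancels w^-1
      against the trailing w.\<close>
    also have "\<dots> = t [^] n \<otimes> (i (w \<otimes>\<^bsub>F\<^esub> u \<otimes>\<^bsub>F\<^esub> inv\<^bsub>F\<^esub> w) \<otimes> i w)"
      using conj_t_pow[OF u, of n] \<phi>_pow_n[OF u] t w u by (simp add: G.m_assoc)
    also have "\<dots> = t [^] n \<otimes> i w \<otimes> i u"
      using t w u by (simp add: G.m_assoc)
    finally show ?thesis by simp
  qed
  \<comment> \<open>Negative powers of t are included because normal forms carry an integer
    exponent.\<close>
  have "?z \<otimes> t [^] (m::int) = t [^] m \<otimes> ?z" for m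
  proof -
    have pow: "?z \<otimes> t [^] k = t [^] k \<otimes> ?z" for k :: nat
      using G.group_commutes_pow[OF z_t[symmetric] t z] by simp
    moreover have "?z \<otimes> inv (t [^] k) = inv (t [^] k) \<otimes> ?z" for k :: nat
      by (rule G.intertwine_inv[OF pow]) (use t z in auto)
    ultimately show ?thesis
      using t by (cases m rule: int_cases2) (auto simp: int_pow_int G.int_pow_neg_int)
  qed
  then have "?z \<otimes> g = g \<otimes> ?z" if "g \<in> carrier G" for g
    using normal_form[OF that] t z z_i by (metis G.int_pow_closed G.m_assoc i.hom_closed)
  then show ?thesis
    using z by (simp add: center_def)
qed

text \<open>Commuting with x equates \<open>t^r \<phi>^r(x) u\<close> with \<open>t^r u x\<close>;
  cancelling t^r and the injective \<open>i\<close> makes \<phi>^r conjugation by u.\<close>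

lemma central_exponent:
  assumes r: "r < n" and u: "u \<in> carrier F" and central: "t [^] r \<otimes> i u \<in> center G"
  shows "r = 0 \<and> u = \<one>\<^bsub>F\<^esub>"
proof -
  have *: "\<phi>_pow r x \<otimes>\<^bsub>F\<^esub> u = u \<otimes>\<^bsub>F\<^esub> x" if x: "x \<in> carrier F" for x
  proof -
    have px: "\<phi>_pow r x \<in> carrier F"
      using x by (rule \<phi>_pow_closed)
    have "t [^] r \<otimes> i (u \<otimes>\<^bsub>F\<^esub> x) = i x \<otimes> (t [^] r \<otimes> i u)"
      using central x u t by (simp add: center_def G.m_assoc)
    also have "\<dots> = (i x \<otimes> t [^] r) \<otimes> i u"
      using x u t by (simp add: G.m_assoc)
    also have "\<dots> = t [^] r \<otimes> i (\<phi>_pow r x \<otimes>\<^bsub>F\<^esub> u)"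
      using x u t px by (simp add: conj_t_pow G.m_assoc)
    finally have "i (u \<otimes>\<^bsub>F\<^esub> x) = i (\<phi>_pow r x \<otimes>\<^bsub>F\<^esub> u)"
      using x u t px by simp
    then show ?thesis
      using inj_onD[OF inj_i] x u px by (metis F.m_closed)
  qed
  have "\<phi>_pow r x = conj_aut F u x" if x: "x \<in> carrier F" for x
  proof -
    have "\<phi>_pow r x \<in> carrier F"
      using x by (rule \<phi>_pow_closed)
    then show ?thesis
      using *[OF x] x u F.inv_solve_right[of "\<phi>_pow r x" "u \<otimes>\<^bsub>F\<^esub> x" u] by (simp add: conj_aut_def)
  qed
  then have "\<phi>_pow r = conj_aut F u"
    using F.auto_pow_apply(1)[OF \<phi>] F.conj_aut_auto[OF u] by (intro auto_eqI[of _ F]) auto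
  then have "\<phi>_pow r \<in> inner_auts F"
    using u by (auto simp: inner_auts_conj_aut)
  then have r0: "r = 0"
    using minimal[of r] r by auto
  \<comment> \<open>As \<phi>^0 is the identity, \<open>*\<close> now says that u commutes with all
    of F.\<close>
  moreover have "u \<in> center F"
    using * u r0 by (auto simp: center_def AutoGroup_simps)
  ultimately show ?thesis
    using center_F by simp
qed

theorem center_cyclic_extension: "center G = generate G {t [^] n \<otimes> i w}"
proof
  define c where "c = t [^] n \<otimes> i w"
  have c: "c \<in> center G" "c \<in> carrier G"
    using central_generator by (auto simp: c_def center_def)
  note sub = G.subgroup_center
  show "generate G {t [^] n \<otimes> i w} \<subseteq> center G"
    using G.generate_subgroup_incl[OF _ sub] c by (simp add: c_def)
  show "center G \<subseteq> generate G {t [^] n \<otimes> i w}"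
  proof
    fix z assume z: "z \<in> center G"
    then have zc: "z \<in> carrier G" by (simp add: center_def)
    \<comment> \<open>Since \<epsilon> sends \<open>c\<close> to n, removing the power
      \<open>c^q\<close> leaves an element whose exponent is the remainder of
      \<open>\<epsilon> z\<close> modulo n.\<close>
    define q where "q = \<epsilon> z div int n"
    define y where "y = z \<otimes> inv (c [^] q)"
    have y: "y \<in> center G"
      unfolding y_def
      by (intro subgroup.m_closed[OF sub] subgroup.m_inv_closed[OF sub] G.subgroup_int_pow_closed[OF sub] z c)
    have "\<epsilon> c = int n"
      using \<epsilon>_normal_form[OF w, of "int n"] by (simp add: c_def int_pow_int)
    then have \<epsilon>_y: "\<epsilon> y = \<epsilon> z mod int n"
      using zc c by (simp add: y_def q_def \<epsilon>.hom_int_pow minus_div_mult_eq_mod)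
    obtain m u where u: "u \<in> carrier F" "y = t [^] (m::int) \<otimes> i u"
      using normal_form[of y] subgroup.mem_carrier[OF sub y] by blast
    then have "m = \<epsilon> z mod int n"
      using \<epsilon>_y \<epsilon>_normal_form by simp
    then have m: "0 \<le> m" "m < int n"
      using n_pos by auto
    \<comment> \<open>The exponent becomes a natural number, as the powers of \<phi> and the
      minimality of n are stated for those.\<close>
    then have "y = t [^] nat m \<otimes> i u"
      using u(2) int_pow_int[of G t "nat m"] by simp
    then have "nat m = 0 \<and> u = \<one>\<^bsub>F\<^esub>"
      using central_exponent[of "nat m" u] m u y by auto
    then have "y = \<one>"
      using \<open>y = t [^] nat m \<otimes> i u\<close> by simp
    then have "z = c [^] q"
      using zc c by (simp add: y_def G.inv_solve_right')
    then show "z \<in> generate G {t [^] n \<otimes> i w}"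
      using G.generate_pow[OF c(2)] by (auto simp: c_def)
  qed
qed

text \<open>\<epsilon> maps the center onto the multiples of n, infinitely many as n > 0. With the
  single generator already found, the center is thus infinite cyclic.\<close>

lemma infinite_center: "infinite (center G)"
proof
  let ?c = "t [^] n \<otimes> i w"
  have c: "?c \<in> carrier G" using t w by simp
  assume "finite (center G)"
  moreover have "center G = range (\<lambda>k::int. ?c [^] k)"
    using G.generate_pow[OF c] center_cyclic_extension by auto
  ultimately have "finite (\<epsilon> ` range (\<lambda>k::int. ?c [^] k))"
    by simp
  moreover have "\<epsilon> ?c = int n"
    using \<epsilon>_normal_form[OF w, of "int n"] by (simp add: int_pow_int)
  then have "\<epsilon> ` range (\<lambda>k::int. ?c [^] k) = range (\<lambda>k. k * int n)"
    using c by (simp add: image_image \<epsilon>.hom_int_pow)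
  moreover have "inj (\<lambda>k. k * int n)"
    using n_pos by (auto simp: inj_def)
  ultimately show False
    using finite_imageD infinite_UNIV_int by metis
qed

end

end


section \<open>Free groups\<close>

text \<open>A nonempty w fails to commute with a suitable letter m on a generator other than that of
  its first letter: both \<open>m w\<close> and \<open>w m\<close> are reduced as they stand, and
  they start differently. A single generator would give an abelian group.\<close>

lemma center_free_group:
  assumes "\<not> is_singleton X"
  shows "center (free_group X) = {\<one>\<^bsub>free_group X\<^esub>}"
proof -
  have "w = []" if w: "w \<in> center (free_group X)" for w
  proof (rule ccontr)
    assume "w \<noteq> []"
    then obtain l v where lv: "w = l # v" by (cases w) auto
    have red: "reduced w" and l: "fst l \<in> X"
      using w lv by (auto simp: center_def free_group_def)
    obtain y where y: "y \<in> X" "y \<noteq> fst l"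
      using assms l is_singletonI'[of X] by blast
    \<comment> \<open>If the last letter of w lies over y, the sign of m repeats its sign, so
      nothing cancels on the right. On the left the generators differ.\<close>
    define m where "m = (y, last w \<noteq> (y, False))"
    have m: "fst m = y" "[m] \<in> carrier (free_group X)"
      using y by (auto simp: m_def free_group_def reduced_Cons)
    have "m \<noteq> inv_letter (last w)"
      by (auto simp: m_def inv_letter_def prod_eq_iff)
    then have "reduced (w @ [m])"
      using red \<open>w \<noteq> []\<close> by (simp add: reduced_def successively_append_iff)
    then have "w \<otimes>\<^bsub>free_group X\<^esub> [m] = w @ [m]"
      using word_mult_Nil_right[of "w @ [m]"] by (simp add: word_mult_append free_group_def)
    moreover have "l \<noteq> inv_letter m"
      using y m by auto
    then have "[m] \<otimes>\<^bsub>free_group X\<^esub> w = m # w"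
      using lv by (simp add: free_group_def)
    ultimately have "m # w = w @ [m]"
      using w m by (simp add: center_def)
    then show False
      using lv y m by auto
  qed
  moreover have "\<one>\<^bsub>free_group X\<^esub> \<in> center (free_group X)"
    using group_free_group[of X] by (simp add: center_def group.is_monoid)
  ultimately show ?thesis
    by (auto simp: free_group_def)
qed

lemma generate_free_gen: "generate (free_group S) (free_gen ` S) = carrier (free_group S)"
proof
  interpret F: group "free_group S" by (rule group_free_group)
  show "generate (free_group S) (free_gen ` S) \<subseteq> carrier (free_group S)"
    by (rule F.generate_incl) auto
  have letter: "[l] \<in> generate (free_group S) (free_gen ` S)" if "fst l \<in> S" for l
  proof (cases l)
    case (Pair x b)
    have "[(x, True)] \<in> generate (free_group S) (free_gen ` S)"
      using that Pair by (intro generate.incl) (auto simp: free_gen_def)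
    moreover have "[(x, False)] \<in> generate (free_group S) (free_gen ` S)"
      using generate.inv[of "free_gen x" "free_gen ` S" "free_group S"] that Pair
      by (simp add: inv_free_gen)
    ultimately show ?thesis using Pair by (cases b) auto
  qed
  show "carrier (free_group S) \<subseteq> generate (free_group S) (free_gen ` S)"
  proof
    fix w assume "w \<in> carrier (free_group S)"
    then show "w \<in> generate (free_group S) (free_gen ` S)"
    proof (induction w)
      case Nil
      then show ?case
        using generate.one[of "free_group S"] by (simp add: free_group_def)
    next
      case (Cons l w)
      have "l # w = [l] \<otimes>\<^bsub>free_group S\<^esub> w"
        using Cons.prems by (cases w) (auto simp: free_group_def reduced_Cons)
      moreover have "w \<in> carrier (free_group S)" "fst l \<in> S"
        using Cons.prems by (auto simp: free_group_def reduced_Cons)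
      ultimately show ?case
        by (simp only:) (intro generate.eng letter Cons.IH)
    qed
  qed
qed

section \<open>Groups given by generators and relators\<close>

lemma presented_group_universal:
  assumes H: "group H" and f: "f \<in> S \<rightarrow> carrier H" and R: "R \<subseteq> carrier (free_group S)"
    and rel: "\<And>h r. \<lbrakk>h \<in> hom (free_group S) H; \<forall>x\<in>S. h (free_gen x) = f x; r \<in> R\<rbrakk> \<Longrightarrow> h r = \<one>\<^bsub>H\<^esub>"
  obtains g where "g \<in> hom (presented_group S R) H"
    "\<And>x. x \<in> S \<Longrightarrow> g (pres_class S R (free_gen x)) = f x"
proof -
  \<comment> \<open>\<open>rel\<close> is assumed for every extension of \<open>f\<close>, so it
    applies to this abstractly obtained \<open>h\<close>, and no relator has to be evaluated letter
    by letter.\<close>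
  obtain h where h: "h \<in> hom (free_group S) H" "\<forall>x\<in>S. h (free_gen x) = f x"
    using free_group_universal(1)[OF H f] by blast
  interpret h: group_hom "free_group S" H h
    using H h by (simp add: group_hom_def group_hom_axioms_def group_free_group)
  have "R \<subseteq> kernel (free_group S) H h"
    using R rel[OF h] by (auto simp: kernel_def)
  \<comment> \<open>The kernel is one of the normal subgroups whose intersection is the normal
    closure, so \<open>h\<close> factors through the quotient.\<close>
  then have "normal_closure (free_group S) R \<subseteq> kernel (free_group S) H h"
    using h.normal_kernel by (auto simp: normal_closure_def)
  then obtain g where "g \<in> hom (free_group S Mod normal_closure (free_group S) R) H"
    "\<And>w. w \<in> carrier (free_group S) \<Longrightarrow> g (normal_closure (free_group S) R #>\<^bsub>free_group S\<^esub> w) = h w"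
    using h.FactGroup_universal_kernel[OF group.normal_normal_closure(1)[OF group_free_group R]] by blast
  then show thesis
    using h(2) that by (simp add: presented_group_def pres_class_def)
qed

lemma pres_class_hom:
  assumes "R \<subseteq> carrier (free_group S)"
  shows "pres_class S R \<in> hom (free_group S) (presented_group S R)"
  using normal.r_coset_hom_Mod[OF group.normal_normal_closure(1)[OF group_free_group assms]]
  unfolding pres_class_def presented_group_def .

lemma pres_class_image: "pres_class S R ` carrier (free_group S) = carrier (presented_group S R)"
  by (simp add: presented_group_def carrier_FactGroup pres_class_def)

lemma pres_class_relator:
  assumes "R \<subseteq> carrier (free_group S)" "r \<in> R"
  shows "pres_class S R r = \<one>\<^bsub>presented_group S R\<^esub>"
proof -
  interpret F: group "free_group S" by (rule group_free_group)
  interpret N: normal "normal_closure (free_group S) R" "free_group S"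
    by (rule F.normal_normal_closure(1)[OF assms(1)])
  show ?thesis
    using F.normal_normal_closure(2)[OF assms(1)] assms(2)
    by (auto simp: pres_class_def presented_group_def N.rcos_const)
qed

section \<open>The inclusion of F(X) into the free group on X and t\<close>

lemma mem_ext_gens [simp]:
  "None \<in> ext_gens X" "Some x \<in> ext_gens X \<longleftrightarrow> x \<in> X"
  by (auto simp: ext_gens_def)

text \<open>\<open>Some\<close> is injective and respects formal inverses of letters, so a
  cancellation occurs after lifting exactly when it occurs before.\<close>

lemma lift_word_hom: "lift_word \<in> hom (free_group X) (free_group (ext_gens X))"
proof (rule homI)
  have letter: "lift_word (cons_reduce l w) = cons_reduce (map_prod Some id l) (lift_word w)"
    for l and w :: "'a word"
    by (cases w) (auto simp: lift_word_def inv_letter_def prod_eq_iff)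
  have "lift_word (word_mult v w) = word_mult (lift_word v) (lift_word w)" for v w :: "'a word"
  proof (induction v)
    case (Cons l v)
    have "lift_word (l # v) = map_prod Some id l # lift_word v"
      by (simp add: lift_word_def)
    with Cons show ?case by (simp add: letter)
  qed (simp add: lift_word_def)
  then show "lift_word (v \<otimes>\<^bsub>free_group X\<^esub> w)
      = lift_word v \<otimes>\<^bsub>free_group (ext_gens X)\<^esub> lift_word w" for v w
    by (simp add: free_group_def)
qed (rule lift_word_closed)

lemma lift_word_free_gen: "lift_word (free_gen x) = free_gen (Some x)"
  by (simp add: lift_word_def free_gen_def)


section \<open>The extension of a free group\<close>

locale free_extension =
  fixes X :: "'a set" and \<phi> :: "'a word \<Rightarrow> 'a word"
  assumes \<phi>: "\<phi> \<in> auto (free_group X)"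
begin

abbreviation F where "F \<equiv> free_group X"
abbreviation E where "E \<equiv> ext_group X \<phi>"
abbreviation t where "t \<equiv> ext_t X \<phi>"
abbreviation \<iota> where "\<iota> \<equiv> ext_incl X \<phi>"

lemma \<phi>_AutoGroup: "\<phi> \<in> carrier (AutoGroup F)"
  using \<phi> by (simp add: AutoGroup_simps)

sublocale F: group F by (rule group_free_group)
sublocale FX: group "free_group (ext_gens X)" by (rule group_free_group)
sublocale E: group E by (rule group_ext_group[OF \<phi>_AutoGroup])
sublocale \<phi>: group_hom F F \<phi> using \<phi> by unfold_locales (simp add: auto_def)

lemmas rels_closed = ext_rels_closed[OF \<phi>_AutoGroup]

abbreviation cls where "cls \<equiv> pres_class (ext_gens X) (ext_rels X \<phi>)"

sublocale cls: group_hom "free_group (ext_gens X)" E cls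
  using pres_class_hom[OF rels_closed] by unfold_locales (simp add: ext_group_def)

sublocale lift: group_hom F "free_group (ext_gens X)" lift_word
  by unfold_locales (rule lift_word_hom)

lemma \<iota>_eq: "\<iota> u = cls (lift_word u)"
  by (simp add: ext_incl_def)

lemma \<iota>_def: "\<iota> = (\<lambda>u. cls (lift_word u))"
  by (rule ext) (rule \<iota>_eq)

sublocale \<iota>: group_hom F E \<iota>
  using hom_compose[OF lift_word_hom cls.homh] by unfold_locales (simp add: comp_def \<iota>_def)

lemma t_closed: "t \<in> carrier E"
  unfolding ext_t_def by (rule cls.hom_closed) simp

lemma \<iota>_free_gen: "\<iota> (free_gen x) = cls (free_gen (Some x))"
  by (simp add: \<iota>_eq lift_word_free_gen)

text \<open>The relators give the rule for generators only. Both \<open>t^-1 \<iota>(u) t\<close>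
  and \<open>\<iota>(\<phi>(u))\<close> are homomorphic in u, so agreement on generators
  suffices.\<close>

lemma conj_t:
  assumes "u \<in> carrier F"
  shows "\<iota> u \<otimes>\<^bsub>E\<^esub> t = t \<otimes>\<^bsub>E\<^esub> \<iota> (\<phi> u)"
proof -
  define c where "c g = inv\<^bsub>E\<^esub> t \<otimes>\<^bsub>E\<^esub> g \<otimes>\<^bsub>E\<^esub> t" for g
  have gen: "c (\<iota> (free_gen x)) = \<iota> (\<phi> (free_gen x))" if x: "x \<in> X" for x
  proof -
    let ?r = "inv\<^bsub>free_group (ext_gens X)\<^esub> free_gen None \<otimes>\<^bsub>free_group (ext_gens X)\<^esub>
        free_gen (Some x) \<otimes>\<^bsub>free_group (ext_gens X)\<^esub> free_gen None \<otimes>\<^bsub>free_group (ext_gens X)\<^esub>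
        inv\<^bsub>free_group (ext_gens X)\<^esub> lift_word (\<phi> (free_gen x))"
    have "?r \<in> ext_rels X \<phi>"
      using x by (simp add: ext_rels_def Let_def)
    then have "cls ?r = \<one>\<^bsub>E\<^esub>"
      using pres_class_relator[OF rels_closed] by (simp add: ext_group_def)
    moreover have "cls ?r = c (\<iota> (free_gen x)) \<otimes>\<^bsub>E\<^esub> inv\<^bsub>E\<^esub> \<iota> (\<phi> (free_gen x))"
      using x by (simp add: c_def \<iota>_eq lift_word_free_gen ext_t_def)
    ultimately show ?thesis
      using x t_closed by (simp add: c_def E.inv_solve_right')
  qed
  have c: "(\<lambda>u. c (\<iota> u)) \<in> hom F E"
    using t_closed
    by (intro homI) (simp_all add: c_def E.m_assoc E.m_assoc[symmetric, of t "inv\<^bsub>E\<^esub> t"])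
  have \<iota>\<phi>: "(\<lambda>u. \<iota> (\<phi> u)) \<in> hom F E"
    by (intro homI) simp_all
  have "c (\<iota> u) = \<iota> (\<phi> u)"
    by (rule free_group_universal(2)[OF E.group_axioms _ c \<iota>\<phi> gen assms,
          where f = "\<lambda>x. \<iota> (free_gen x)"]) auto
  then show ?thesis
    using assms t_closed by (auto simp: c_def E.m_assoc E.inv_solve_left')
qed

lemma generated: "carrier E = generate E (insert t (\<iota> ` carrier F))"
proof
  show "generate E (insert t (\<iota> ` carrier F)) \<subseteq> carrier E"
    using t_closed by (intro E.generate_incl) auto
  have "carrier E = cls ` generate (free_group (ext_gens X)) (free_gen ` ext_gens X)"
    by (simp add: generate_free_gen ext_group_def pres_class_image)
  also have "\<dots> = generate E (cls ` free_gen ` ext_gens X)"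
    by (rule cls.generate_img[symmetric]) auto
  also have "\<dots> \<subseteq> generate E (insert t (\<iota> ` carrier F))"
  proof (rule E.mono_generate)
    have "cls (free_gen y) \<in> insert t (\<iota> ` carrier F)" if "y \<in> ext_gens X" for y
    proof (cases y)
      case None
      then show ?thesis by (simp add: ext_t_def)
    next
      case (Some x)
      then have "\<iota> (free_gen x) \<in> \<iota> ` carrier F"
        using that by (intro imageI) simp
      then show ?thesis using Some by (simp add: \<iota>_free_gen)
    qed
    then show "cls ` free_gen ` ext_gens X \<subseteq> insert t (\<iota> ` carrier F)"
      by blast
  qed
  finally show "carrier E \<subseteq> generate E (insert t (\<iota> ` carrier F))" .
qed

text \<open>Used for two targets: Aut(F), for the injectivity of \<iota>, and the integers, for the
  exponent sum of t.\<close>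

lemma ext_group_universal:
  assumes H: "group H" and s: "s \<in> carrier H" and f: "f \<in> hom F H"
    and rel: "\<And>x. x \<in> X \<Longrightarrow> f (free_gen x) \<otimes>\<^bsub>H\<^esub> s = s \<otimes>\<^bsub>H\<^esub> f (\<phi> (free_gen x))"
  obtains g where "g \<in> hom E H" "g t = s" "\<And>u. u \<in> carrier F \<Longrightarrow> g (\<iota> u) = f u"
proof -
  interpret H: group H by (rule H)
  interpret f: group_hom F H f using f by unfold_locales
  define f' where "f' = case_option s (\<lambda>x. f (free_gen x))"
  have f': "f' \<in> ext_gens X \<rightarrow> carrier H"
    using s by (auto simp: f'_def ext_gens_def)
  obtain g where g: "g \<in> hom (presented_group (ext_gens X) (ext_rels X \<phi>)) H"
    "\<And>x. x \<in> ext_gens X \<Longrightarrow> g (cls (free_gen x)) = f' x"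
  proof (rule presented_group_universal[OF H f' rels_closed])
    fix h r
    assume h: "h \<in> hom (free_group (ext_gens X)) H" and h_gen: "\<forall>x\<in>ext_gens X. h (free_gen x) = f' x"
      and r: "r \<in> ext_rels X \<phi>"
    interpret h: group_hom "free_group (ext_gens X)" H h using h by unfold_locales
    have hx: "h (free_gen None) = s" "\<And>x. x \<in> X \<Longrightarrow> h (free_gen (Some x)) = f (free_gen x)"
      using h_gen by (auto simp: f'_def ext_gens_def)
    \<comment> \<open>The relator contains the whole word \<phi>(x), so \<open>h\<close> must be
      known on all lifted words, not just on generators; uniqueness in the universal property gives
      this.\<close>
    have h_lift: "h (lift_word u) = f u" if "u \<in> carrier F" for u
    proof (rule free_group_universal(2)[OF H, where S = X and f = "\<lambda>x. f (free_gen x)"])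
      show "(\<lambda>u. h (lift_word u)) \<in> hom F H"
        using hom_compose[OF lift_word_hom h] by (simp add: comp_def)
    qed (use f that hx in \<open>auto simp: lift_word_free_gen\<close>)
    obtain x where x: "x \<in> X" "r = inv\<^bsub>free_group (ext_gens X)\<^esub> free_gen None \<otimes>\<^bsub>free_group (ext_gens X)\<^esub>
        free_gen (Some x) \<otimes>\<^bsub>free_group (ext_gens X)\<^esub> free_gen None \<otimes>\<^bsub>free_group (ext_gens X)\<^esub>
        inv\<^bsub>free_group (ext_gens X)\<^esub> lift_word (\<phi> (free_gen x))"
      using r by (auto simp: ext_rels_def Let_def)
    then have "h r = inv\<^bsub>H\<^esub> s \<otimes>\<^bsub>H\<^esub> (f (free_gen x) \<otimes>\<^bsub>H\<^esub> s) \<otimes>\<^bsub>H\<^esub> inv\<^bsub>H\<^esub> f (\<phi> (free_gen x))"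
      using s by (simp add: hx h_lift H.m_assoc)
    then show "h r = \<one>\<^bsub>H\<^esub>"
      using x s by (simp add: rel) (simp flip: H.m_assoc)
  qed blast
  have gE: "g \<in> hom E H"
    using g(1) by (simp add: ext_group_def)
  have "g t = s"
    using g(2)[of None] by (simp add: f'_def ext_gens_def ext_t_def)
  moreover have "g (\<iota> u) = f u" if "u \<in> carrier F" for u
  proof (rule free_group_universal(2)[OF H, where S = X and f = "\<lambda>x. f (free_gen x)"])
    show "(\<lambda>u. g (\<iota> u)) \<in> hom F H"
      using hom_compose[OF \<iota>.homh gE] by (simp add: comp_def)
    show "g (\<iota> (free_gen x)) = f (free_gen x)" if "x \<in> X" for x
      using that g(2)[of "Some x"] by (simp add: \<iota>_free_gen f'_def ext_gens_def)
  qed (use f that in auto)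
  ultimately show thesis
    using gE that by blast
qed

text \<open>
  When \<open>F\<close> is centreless, the relations of the extension also hold in \<open>Aut(F)\<close> for \<open>\<phi>\<inverse>\<close> in
  place of \<open>t\<close> and conjugation by \<open>x\<close> in place of \<open>x\<close>, so no semidirect product is needed.
\<close>

lemma inj_\<iota>:
  assumes "\<not> is_singleton X"
  shows "inj_on \<iota> (carrier F)"
proof -
  interpret A: group "AutoGroup F" by (rule F.AutoGroup)
  interpret c: group_hom F "AutoGroup F" "conj_aut F"
    by unfold_locales (rule F.conj_aut_hom)
  obtain g where "g \<in> hom E (AutoGroup F)" and g: "\<And>u. u \<in> carrier F \<Longrightarrow> g (\<iota> u) = conj_aut F u"
  proof (rule ext_group_universal[OF A.group_axioms _ F.conj_aut_hom])
    show "inv\<^bsub>AutoGroup F\<^esub> \<phi> \<in> carrier (AutoGroup F)"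
      using \<phi>_AutoGroup by simp
    show "conj_aut F (free_gen x) \<otimes>\<^bsub>AutoGroup F\<^esub> inv\<^bsub>AutoGroup F\<^esub> \<phi>
        = inv\<^bsub>AutoGroup F\<^esub> \<phi> \<otimes>\<^bsub>AutoGroup F\<^esub> conj_aut F (\<phi> (free_gen x))" if "x \<in> X" for x
    proof -
      \<comment> \<open>The rule for \<phi> itself; \<open>intertwine_inv\<close> then yields the
        one with the inverse of \<phi> in the role of t.\<close>
      have "\<phi> \<otimes>\<^bsub>AutoGroup F\<^esub> conj_aut F (free_gen x)
          = conj_aut F (\<phi> (free_gen x)) \<otimes>\<^bsub>AutoGroup F\<^esub> \<phi>"
        using F.auto_conj_aut[OF \<phi>] that by simp
      then show ?thesis
        using that \<phi>_AutoGroup by (intro A.intertwine_inv) auto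
    qed
  qed blast
  show ?thesis
  proof (rule inj_onI)
    fix u v assume "u \<in> carrier F" "v \<in> carrier F" "\<iota> u = \<iota> v"
    \<comment> \<open>\<open>g\<close> after \<iota> is the map to conjugations, which is injective;
      hence so is \<iota>.\<close>
    then show "u = v"
      using g F.inj_conj_aut[OF center_free_group[OF assms]] by (metis inj_onD)
  qed
qed

text \<open>\<open>is_conjugator\<close> tests generators only, but homomorphisms that agree there
  agree on F, and extensionality makes them equal as functions.\<close>

lemma is_conjugator_iff:
  assumes \<psi>: "\<psi> \<in> auto F"
  shows "is_conjugator X \<psi> w \<longleftrightarrow> w \<in> carrier F \<and> \<psi> = conj_aut F w"
proof
  assume w: "is_conjugator X \<psi> w"
  have "\<psi> u = conj_aut F w u" if "u \<in> carrier F" for u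
    by (rule free_group_universal(2)[OF F.group_axioms, where S = X and f = free_gen
          and h = \<psi> and h' = "conj_aut F w"])
       (use w \<psi> that F.conj_aut_auto[of w] in \<open>auto simp: is_conjugator_def auto_def conj_aut_def\<close>)
  then show "w \<in> carrier F \<and> \<psi> = conj_aut F w"
    using w \<psi> F.conj_aut_auto[of w] by (auto simp: is_conjugator_def intro: auto_eqI)
qed (auto simp: is_conjugator_def conj_aut_def)

end

theorem proposition1:
  fixes X :: "'a set" and \<phi> :: "'a word \<Rightarrow> 'a word" and n :: nat
  assumes "\<not> is_singleton X"
    and "virtually_inner (free_group X) \<phi>"
    and "n = (LEAST k::nat. k > 0 \<and> \<phi> [^]\<^bsub>AutoGroup (free_group X)\<^esub> k \<in> inner_auts (free_group X))"
  shows "(\<exists>!w\<^sub>0. is_conjugator X (\<phi> [^]\<^bsub>AutoGroup (free_group X)\<^esub> n) w\<^sub>0) \<and>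
    (\<forall>w\<^sub>0. is_conjugator X (\<phi> [^]\<^bsub>AutoGroup (free_group X)\<^esub> n) w\<^sub>0 \<longrightarrow>
       center (ext_group X \<phi>)
         = generate (ext_group X \<phi>)
             {ext_t X \<phi> [^]\<^bsub>ext_group X \<phi>\<^esub> n \<otimes>\<^bsub>ext_group X \<phi>\<^esub> ext_incl X \<phi> w\<^sub>0} \<and>
       infinite (center (ext_group X \<phi>)))"
proof -
  let ?F = "free_group X"
  let ?P = "\<lambda>k::nat. k > 0 \<and> \<phi> [^]\<^bsub>AutoGroup ?F\<^esub> k \<in> inner_auts ?F"
  interpret free_extension X \<phi>
    using assms(2) by unfold_locales (simp add: virtually_inner_def AutoGroup_simps)
  have "\<exists>k. ?P k"
    using assms(2) by (simp add: virtually_inner_def)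
  then have n: "?P n"
    unfolding assms(3) by (rule LeastI_ex)
  have minimal: "\<phi> [^]\<^bsub>AutoGroup ?F\<^esub> k \<notin> inner_auts ?F" if "0 < k" "k < n" for k
    using not_less_Least[of k ?P] that assms(3) by simp
  have cen: "center ?F = {\<one>\<^bsub>?F\<^esub>}"
    by (rule center_free_group[OF assms(1)])
  have conj: "is_conjugator X (\<phi> [^]\<^bsub>AutoGroup ?F\<^esub> n) w
      \<longleftrightarrow> w \<in> carrier ?F \<and> \<phi> [^]\<^bsub>AutoGroup ?F\<^esub> n = conj_aut ?F w" for w
    by (rule is_conjugator_iff[OF F.auto_pow_apply(1)[OF \<phi>]])
  \<comment> \<open>The exponent sum of t: in the additive integers the defining relation becomes 0
    + 1 = 1 + 0.\<close>
  obtain \<epsilon> where \<epsilon>: "\<epsilon> \<in> hom E integer_group" "\<epsilon> t = 1" "\<And>u. u \<in> carrier ?F \<Longrightarrow> \<epsilon> (\<iota> u) = 0"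
    by (rule ext_group_universal[of integer_group 1 "\<lambda>_. 0"]) (auto intro: homI)
  interpret cyclic_extension E ?F \<iota> \<phi> t \<epsilon>
    by unfold_locales (use inj_\<iota>[OF assms(1)] \<phi> t_closed conj_t generated \<epsilon> in auto)
  obtain v where "v \<in> carrier ?F" "\<phi> [^]\<^bsub>AutoGroup ?F\<^esub> n = conj_aut ?F v"
    using n by (auto simp: inner_auts_conj_aut)
  \<comment> \<open>Existence is that \<phi>^n is inner; uniqueness is the injectivity of
    \<open>conj_aut\<close> for trivial center.\<close>
  then have "\<exists>!w. is_conjugator X (\<phi> [^]\<^bsub>AutoGroup ?F\<^esub> n) w"
    unfolding conj using inj_onD[OF F.inj_conj_aut[OF cen]] by metis
  moreover have "center E = generate E {t [^]\<^bsub>E\<^esub> n \<otimes>\<^bsub>E\<^esub> \<iota> w} \<and> infinite (center E)"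
    if "is_conjugator X (\<phi> [^]\<^bsub>AutoGroup ?F\<^esub> n) w" for w
  proof -
    have w: "w \<in> carrier ?F" and "\<phi> [^]\<^bsub>AutoGroup ?F\<^esub> n = conj_aut ?F w"
      using that conj by auto
    then have "(\<phi> [^]\<^bsub>AutoGroup ?F\<^esub> n) u = w \<otimes>\<^bsub>?F\<^esub> u \<otimes>\<^bsub>?F\<^esub> inv\<^bsub>?F\<^esub> w" if "u \<in> carrier ?F" for u
      using that by (simp add: conj_aut_def)
    then show ?thesis
      using center_cyclic_extension[OF cen _ minimal w] infinite_center[OF cen _ minimal w] n by blast
  qed
  ultimately show ?thesis by blast
qed

end
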